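(* Let $\mathcal{U}$ be a finite set of atoms with $u = |\mathcal{U}|$. For all natural numbers $n > m \geq 1$, \[ b^u_{n,m} = b^u_{n,m-1} + \sum_{k=1}^{n-m-1} b^u_{n-k,m-1} \binom{b^u_{m,m-1}}{k} + \binom{b^u_{m,m-1}}{n-m} \left( 1 + \sum_{k=1}^m b^u_{k,k-1} \right), \] where $b^u_{0,-1} = u+1$ and $b^u_{n,0} = \binom{u+1}{n}$ for all $n \geq 1$, and where $\binom{a}{b} = 0$ if $a < b$.
   Context: Atoms (urelements) are objects with no elements, pairwise distinct and distinct from all sets (in particular from $\emptyset$). Given a finite set $\mathcal{U}$ of atoms, the adjunctive hierarchy with atoms is $A^{\mathcal{U}}_0 := \{\emptyset\} \cup \mathcal{U}$ and $A^{\mathcal{U}}_{n+1} := \{\emptyset\} \cup \mathcal{U} \cup \{ x \cup \{y\} : x \in A^{\mathcal{U}}_n \setminus \mathcal{U},\ y \in A^{\mathcal{U}}_n\}$, with $A^{\mathcal{U}}_n := \emptyset$ for $n < 0$. For integers $n,m$, let $B^{\mathcal{U}}_{n,m} := \{x \in A^{\mathcal{U}}_n \setminus A^{\mathcal{U}}_{n-1} : x \subseteq A^{\mathcal{U}}_m\}$, where "$x \subseteq A^{\mathcal{U}}_m$" means every element of $x$ lies in $A^{\mathcal{U}}_m$ (vacuously true for atoms), and $b^u_{n,m} := |B^{\mathcal{U}}_{n,m}|$. (Thus $|A^{\mathcal{U}}_n| = \sum_{k=0}^n b^u_{k,k-1}$.) *)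

theory Defs
  imports Main "HOL-Library.FSet"
begin

text \<open>
  Every object of the adjunctive hierarchy is an atom or a hereditarily finite set over atoms,
  so the following type serves as the universe: it is extensional for sets, its atoms are pairwise
  distinct and distinct from all sets, and they have no elements. A set of atoms is given by a set
  of labels \<open>U :: 'a set\<close>, which stands for \<open>Atom ` U\<close>.
\<close>

datatype 'a hfa = Atom 'a | HSet "'a hfa fset"

fun elems :: "'a hfa \<Rightarrow> 'a hfa set" where
  "elems (Atom a) = {}"
| "elems (HSet X) = fset X"

primrec adj_level :: "'a set \<Rightarrow> nat \<Rightarrow> 'a hfa set" where
  "adj_level U 0 = {HSet {||}} \<union> Atom ` U"
| "adj_level U (Suc n) = {HSet {||}} \<union> Atom ` U \<union>
     {HSet (finsert y X) | X y. HSet X \<in> adj_level U n - Atom ` U \<and> y \<in> adj_level U n}"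

definition A :: "'a set \<Rightarrow> int \<Rightarrow> 'a hfa set" where
  "A U n = (if n < 0 then {} else adj_level U (nat n))"

definition B :: "'a set \<Rightarrow> int \<Rightarrow> int \<Rightarrow> 'a hfa set" where
  "B U n m = {x \<in> A U n - A U (n - 1). elems x \<subseteq> A U m}"

definition b :: "'a set \<Rightarrow> int \<Rightarrow> int \<Rightarrow> nat" where
  "b U n m = card (B U n m)"

end

theory Submission
  imports Defs
begin

text \<open>
  Split \<open>x \<subseteq> A\<^sub>m\<close> into \<open>s = x \<inter> A\<^sub>m\<^sub>-\<^sub>1\<close> and \<open>t = x - A\<^sub>m\<^sub>-\<^sub>1\<close> with \<open>k = |t|\<close>. It is optimal to adjoin
  the elements of \<open>t\<close> after those of \<open>s\<close>, and each of them costs one level. Hence, for \<open>k \<ge> 1\<close>,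
  \<open>x \<in> A\<^sub>n\<close> iff \<open>n - k \<ge> m\<close> and \<open>s \<in> A\<^sub>n\<^sub>-\<^sub>k\<close>. So \<open>x\<close> first appears at level \<open>n\<close> iff either
  \<open>k < n - m\<close> and \<open>s\<close> first appears at level \<open>n - k\<close>, or \<open>k = n - m\<close> and \<open>s\<close> is an arbitrary set
  in \<open>A\<^sub>m\<close>; counting the pairs \<open>(s, t)\<close> gives the recurrence.
\<close>

section \<open>Membership in the levels and closure properties\<close>

lemma HSet_empty_in_adj_level [simp]: "HSet {||} \<in> adj_level U n"
  by (cases n) auto

lemma Atom_in_adj_level [simp]: "Atom a \<in> adj_level U n \<longleftrightarrow> a \<in> U"
  by (cases n) auto

lemma HSet_in_adj_level_0 [simp]: "HSet X \<in> adj_level U 0 \<longleftrightarrow> X = {||}"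
  by auto

lemma HSet_in_adj_level_Suc_iff:
  "HSet X \<in> adj_level U (Suc n) \<longleftrightarrow>
     X = {||} \<or> (\<exists>Y y. X = finsert y Y \<and> HSet Y \<in> adj_level U n \<and> y \<in> adj_level U n)"
  by auto

declare adj_level.simps [simp del]
declare fcard_fempty [simp]

lemma adj_level_Suc_mono: "adj_level U n \<subseteq> adj_level U (Suc n)"
proof (induction n)
  case 0
  then show ?case by (auto simp: adj_level.simps)
next
  case (Suc n)
  show ?case
  proof
    fix x assume x: "x \<in> adj_level U (Suc n)"
    show "x \<in> adj_level U (Suc (Suc n))"
    proof (cases x)
      case (Atom a)
      with x show ?thesis by (simp only: Atom_in_adj_level)
    next
      case (HSet X)
      with x Suc show ?thesis by (simp only: HSet_in_adj_level_Suc_iff) blast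
    qed
  qed
qed

lemma adj_level_mono: "m \<le> n \<Longrightarrow> adj_level U m \<subseteq> adj_level U n"
  by (rule lift_Suc_mono_le[of "adj_level U"]) (use adj_level_Suc_mono in auto)

text \<open>Omit from the construction of \<open>X\<close> every step that adjoins an element
  outside \<open>Y\<close>; the remaining steps build \<open>Y\<close> no later than
  \<open>X\<close>.\<close>

lemma adj_level_subset_closed:
  "HSet X \<in> adj_level U n \<Longrightarrow> Y |\<subseteq>| X \<Longrightarrow> HSet Y \<in> adj_level U n"
proof (induction n arbitrary: X Y)
  case 0
  then show ?case by auto
next
  case (Suc n)
  show ?case
  proof (cases "Y = {||}")
    case False
    with Suc.prems obtain y Z where X: "X = finsert y Z"
      and Z: "HSet Z \<in> adj_level U n" and y: "y \<in> adj_level U n"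
      by (auto simp only: HSet_in_adj_level_Suc_iff)
    have "Y |-| {|y|} |\<subseteq>| Z" using Suc.prems(2) X by auto
    then have "HSet (Y |-| {|y|}) \<in> adj_level U n" using Suc.IH Z by blast
    then have "HSet (finsert y (Y |-| {|y|})) \<in> adj_level U (Suc n)"
      using y unfolding HSet_in_adj_level_Suc_iff by blast
    moreover have "HSet Y \<in> adj_level U (Suc n)" if "y |\<notin>| Y"
    proof -
      have "Y |\<subseteq>| Z" using that Suc.prems(2) X by auto
      then show ?thesis using Suc.IH Z adj_level_Suc_mono by blast
    qed
    ultimately show ?thesis
      by (cases "y |\<in>| Y") (simp_all add: finsert_absorb)
  qed simp
qed

text \<open>In the defining clause the adjoined \<open>y\<close> may already belong to the
  predecessor. Subset closure allows shrinking the predecessor to \<open>X |-| {|y|}\<close>, so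
  that the last element can be taken as new; inductions on the level use this form.\<close>

lemma HSet_in_adj_level_Suc_remove_iff:
  "HSet X \<in> adj_level U (Suc n) \<longleftrightarrow>
     X = {||} \<or> (\<exists>y. y |\<in>| X \<and> y \<in> adj_level U n \<and> HSet (X |-| {|y|}) \<in> adj_level U n)"
  (is "?L \<longleftrightarrow> ?R")
proof
  assume ?L
  then consider "X = {||}" | Y y where "X = finsert y Y" "HSet Y \<in> adj_level U n" "y \<in> adj_level U n"
    unfolding HSet_in_adj_level_Suc_iff by blast
  then show ?R
  proof cases
    case (2 Y y)
    have "X |-| {|y|} |\<subseteq>| Y" using 2(1) by auto
    then have "HSet (X |-| {|y|}) \<in> adj_level U n"
      by (rule adj_level_subset_closed[OF 2(2)])
    with 2 show ?thesis by blast
  qed simp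
next
  assume ?R
  then show ?L
  proof
    assume "\<exists>y. y |\<in>| X \<and> y \<in> adj_level U n \<and> HSet (X |-| {|y|}) \<in> adj_level U n"
    then obtain y where y: "y |\<in>| X" "y \<in> adj_level U n" "HSet (X |-| {|y|}) \<in> adj_level U n"
      by blast
    then have "X = finsert y (X |-| {|y|})" by auto
    with y show ?L unfolding HSet_in_adj_level_Suc_iff by blast
  qed simp
qed

text \<open>An element must be available one level before it is adjoined, and levels only grow. This
  makes the inclusion condition in b_{n,n-1} vacuous, so that number counts a whole layer.\<close>

lemma elems_adj_level_Suc: "x \<in> adj_level U (Suc n) \<Longrightarrow> elems x \<subseteq> adj_level U n"
proof (induction n arbitrary: x)
  case 0
  then show ?case by (auto simp: adj_level.simps)
next
  case (Suc n)
  show ?case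
  proof (cases x)
    case (HSet X)
    with Suc.prems consider "X = {||}"
      | Y y where "X = finsert y Y" "HSet Y \<in> adj_level U (Suc n)" "y \<in> adj_level U (Suc n)"
      by (auto simp only: HSet_in_adj_level_Suc_iff)
    then show ?thesis
    proof cases
      case (2 Y y)
      have "fset Y \<subseteq> adj_level U n" using Suc.IH[OF 2(2)] by simp
      then have "fset Y \<subseteq> adj_level U (Suc n)" using adj_level_Suc_mono by blast
      with HSet 2 show ?thesis by simp
    qed (use HSet in simp)
  qed simp
qed

lemma finite_adj_level:
  assumes "finite U"
  shows "finite (adj_level U n)"
proof (induction n)
  case (Suc n)
  have "adj_level U (Suc n) \<subseteq> {HSet {||}} \<union> Atom ` U \<union>
      (\<lambda>(X, y). HSet (finsert y X)) ` ((HSet -` adj_level U n) \<times> adj_level U n)"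
    by (auto simp: adj_level.simps)
  moreover have "finite (HSet -` adj_level U n)"
    by (rule finite_vimageI[OF Suc]) (simp add: inj_def)
  ultimately show ?case
    using Suc assms by (blast intro: finite_subset)
qed (use assms in \<open>simp add: adj_level.simps\<close>)

section \<open>The level of a union of two parts\<close>

lemma HSet_funion_in_adj_level:
  assumes "HSet s \<in> adj_level U n" and "fset t \<subseteq> adj_level U n"
  shows "HSet (s |\<union>| t) \<in> adj_level U (n + fcard t)"
  using assms(2)
proof (induction t)
  case empty
  with assms show ?case by simp
next
  case (insert y t)
  then have "HSet (s |\<union>| t) \<in> adj_level U (n + fcard t)"
    and "y \<in> adj_level U (n + fcard t)"
    using adj_level_mono[of n "n + fcard t" U] by auto
  then have "HSet (finsert y (s |\<union>| t)) \<in> adj_level U (Suc (n + fcard t))"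
    unfolding HSet_in_adj_level_Suc_iff by blast
  with insert.hyps show ?case by (simp add: fcard_finsert_disjoint)
qed

text \<open>
  For the converse, look at the last element \<open>y\<close> adjoined: if \<open>y \<in> s\<close>, it can be adjoined to
  \<open>s - {y}\<close> before \<open>t\<close> at no extra cost.
\<close>

lemma HSet_funion_in_adj_levelD:
  assumes "HSet (s |\<union>| t) \<in> adj_level U n" and "t \<noteq> {||}" and "s |\<inter>| t = {||}"
    and "fset s \<subseteq> adj_level U m" and "\<And>j. j < m \<Longrightarrow> fset t \<inter> adj_level U j = {}"
  shows "m + fcard t \<le> n \<and> HSet s \<in> adj_level U (n - fcard t)"
  using assms
proof (induction n arbitrary: s t)
  case 0
  then show ?case by auto
next
  case (Suc n)
  from Suc.prems(1,2) obtain y where y: "y |\<in>| s |\<union>| t" "y \<in> adj_level U n"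
    and r: "HSet ((s |\<union>| t) |-| {|y|}) \<in> adj_level U n"
    unfolding HSet_in_adj_level_Suc_remove_iff by auto
  show ?case
  proof (cases "y |\<in>| t")
    case True
    define t' where "t' = t |-| {|y|}"
    have t: "t = finsert y t'" "y |\<notin>| t'" using True by (auto simp: t'_def)
    have card: "fcard t = Suc (fcard t')" using t by (simp add: fcard_finsert_disjoint)
    have "y |\<notin>| s" using True Suc.prems(3) by auto
    then have "(s |\<union>| t) |-| {|y|} = s |\<union>| t'" using t by auto
    with r have r': "HSet (s |\<union>| t') \<in> adj_level U n" by simp
    show ?thesis
    proof (cases "t' = {||}")
      case True
      \<comment> \<open>Here \<open>t\<close> is just \<open>{|y|}\<close>. The bound by
        \<open>m\<close> originates here: \<open>y\<close> is in level \<open>n\<close>, but no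
        element of \<open>t\<close> is in a level below \<open>m\<close>.\<close>
      have "m \<le> n" using y(2) Suc.prems(5)[of n] \<open>y |\<in>| t\<close> by (meson disjoint_iff not_le)
      then show ?thesis using True r' card by simp
    next
      case False
      have "m + fcard t' \<le> n \<and> HSet s \<in> adj_level U (n - fcard t')"
        using Suc.prems(3-5) t by (intro Suc.IH[OF r' False]) auto
      then show ?thesis using card by simp
    qed
  next
    case False
    define s' where "s' = s |-| {|y|}"
    have s: "s = finsert y s'" using False y(1) by (auto simp: s'_def)
    have "(s |\<union>| t) |-| {|y|} = s' |\<union>| t" using False by (auto simp: s'_def)
    with r have r': "HSet (s' |\<union>| t) \<in> adj_level U n" by simp
    have IH: "m + fcard t \<le> n" "HSet s' \<in> adj_level U (n - fcard t)"
      using Suc.IH[OF r' Suc.prems(2)] Suc.prems(3-5) s by auto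
    \<comment> \<open>As an element of \<open>s\<close>, \<open>y\<close> is in level
      \<open>m\<close>, and the induction hypothesis gives \<open>m <= n - fcard t\<close>; so
      \<open>y\<close> is available when \<open>s'\<close> is.\<close>
    have "y \<in> adj_level U (n - fcard t)"
      using Suc.prems(4) s adj_level_mono[OF add_le_imp_le_diff[OF IH(1)]] by auto
    then have "HSet s \<in> adj_level U (Suc (n - fcard t))"
      using IH(2) s unfolding HSet_in_adj_level_Suc_iff by blast
    then show ?thesis using IH(1) by (simp add: Suc_diff_le)
  qed
qed

text \<open>The two preceding lemmas combined. The case of empty \<open>t\<close> has to be
  excluded, since the right side would then still demand \<open>m <= n\<close>, although
  \<open>s\<close> may appear below level \<open>m\<close>.\<close>

lemma HSet_funion_in_adj_level_iff:
  assumes "t \<noteq> {||}" and "s |\<inter>| t = {||}"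
    and "fset s \<subseteq> adj_level U m" and "fset t \<subseteq> adj_level U m"
    and "\<And>j. j < m \<Longrightarrow> fset t \<inter> adj_level U j = {}"
  shows "HSet (s |\<union>| t) \<in> adj_level U n \<longleftrightarrow>
    m + fcard t \<le> n \<and> HSet s \<in> adj_level U (n - fcard t)"
proof
  assume R: "m + fcard t \<le> n \<and> HSet s \<in> adj_level U (n - fcard t)"
  then have "fset t \<subseteq> adj_level U (n - fcard t)"
    using assms(4) adj_level_mono[of m "n - fcard t" U] by (meson add_le_imp_le_diff order_trans)
  with R show "HSet (s |\<union>| t) \<in> adj_level U n"
    using HSet_funion_in_adj_level[of s U "n - fcard t" t] by simp
qed (use HSet_funion_in_adj_levelD assms in blast)

section \<open>Cardinalities of subsets and layers\<close>

lemma card_fsubsets: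
  assumes "finite D"
  shows "card {t. fset t \<subseteq> D \<and> fcard t = k} = card D choose k"
proof -
  have "fset ` {t. fset t \<subseteq> D \<and> fcard t = k} = {T. T \<subseteq> D \<and> card T = k}"
  proof (intro equalityI subsetI)
    fix T assume T: "T \<in> {T. T \<subseteq> D \<and> card T = k}"
    then have "finite T" using assms finite_subset by auto
    with T show "T \<in> fset ` {t. fset t \<subseteq> D \<and> fcard t = k}"
      by (intro image_eqI[of _ _ "Abs_fset T"]) (auto simp: Abs_fset_inverse fcard.rep_eq)
  qed (auto simp: fcard.rep_eq)
  then have "card {t. fset t \<subseteq> D \<and> fcard t = k} = card {T. T \<subseteq> D \<and> card T = k}"
    by (metis (no_types, lifting) card_image fset_inject inj_onI)
  with n_subsets[OF assms] show ?thesis by simp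
qed

lemma A_int [simp]: "A U (int n) = adj_level U n"
  by (simp add: A_def)

text \<open>All atoms enter at level 0, so a later layer consists of sets only. Stripping
  \<open>HSet\<close> moves the counting to finite sets.\<close>

lemma B_int_Suc: "B U (int (Suc n)) (int m) =
    HSet ` {X. HSet X \<in> adj_level U (Suc n) - adj_level U n \<and> fset X \<subseteq> adj_level U m}"
proof -
  have "x \<in> HSet ` {X. HSet X \<in> adj_level U (Suc n) - adj_level U n \<and> fset X \<subseteq> adj_level U m}"
    if "x \<in> adj_level U (Suc n)" "x \<notin> adj_level U n" "elems x \<subseteq> adj_level U m" for x
    using that by (cases x) auto
  moreover have "A U (int (Suc n) - 1) = adj_level U n"
    using A_int[of U n] by simp
  ultimately show ?thesis
    unfolding B_def A_int by auto
qed

lemma b_int_Suc: "b U (int (Suc n)) (int m) =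
    card {X. HSet X \<in> adj_level U (Suc n) - adj_level U n \<and> fset X \<subseteq> adj_level U m}"
  unfolding b_def B_int_Suc by (rule card_image) (simp add: inj_on_def)

lemma B_Suc_diag: "B U (int (Suc n)) (int n) = adj_level U (Suc n) - adj_level U n"
proof -
  have "A U (int (Suc n) - 1) = adj_level U n"
    using A_int[of U n] by simp
  then show ?thesis
    unfolding B_def A_int using elems_adj_level_Suc by blast
qed

lemma finite_HSet_vimage: "finite U \<Longrightarrow> finite {X. HSet X \<in> adj_level U n}"
  using finite_vimageI[OF finite_adj_level, of U HSet n] by (simp add: inj_def vimage_def)

text \<open>The 1 is the empty set, the only set at level 0; each later layer adds only sets. This
  counts the arbitrary \<open>s\<close> in the last term of the recurrence.\<close>

lemma card_HSet_adj_level: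
  assumes "finite U"
  shows "card {X. HSet X \<in> adj_level U m} = 1 + (\<Sum>k = 1..m. b U (int k) (int k - 1))"
proof (induction m)
  case (Suc m)
  have "{X. HSet X \<in> adj_level U (Suc m)} =
      {X. HSet X \<in> adj_level U m} \<union>
      {X. HSet X \<in> adj_level U (Suc m) - adj_level U m \<and> fset X \<subseteq> adj_level U m}"
    using elems_adj_level_Suc[of _ U m] adj_level_Suc_mono[of U m]
    by (fastforce)
  then have "card {X. HSet X \<in> adj_level U (Suc m)} =
      card {X. HSet X \<in> adj_level U m} + b U (int (Suc m)) (int m)"
    unfolding b_int_Suc
    using finite_HSet_vimage[OF assms, of m] finite_HSet_vimage[OF assms, of "Suc m"]
    by (simp only:) (rule card_Un_disjoint, auto)
  with Suc show ?case by simp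
qed simp

section \<open>Boundary values\<close>

lemma b_0: "finite U \<Longrightarrow> b U 0 (- 1) = card U + 1"
proof -
  assume "finite U"
  \<comment> \<open>\<open>A U (- 1)\<close> is empty, so all of level 0 is new, and its members
    have no elements that could violate the inclusion.\<close>
  have "B U 0 (- 1) = insert (HSet {||}) (Atom ` U)"
    by (auto simp: B_def A_def adj_level.simps)
  with \<open>finite U\<close> show ?thesis
    by (auto simp: b_def card_image inj_on_def card_insert_if)
qed

lemma b_n_0:
  assumes "finite U" and "n \<ge> 1"
  shows "b U (int n) 0 = (card U + 1) choose n"
proof -
  obtain n' where n: "n = Suc n'" using assms(2) by (cases n) auto
  \<comment> \<open>The splitting criterion with \<open>s = {||}\<close> and \<open>m = 0\<close>: a
    set of level-0 objects first appears at the level given by its cardinality.\<close>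
  have lev: "HSet t \<in> adj_level U N \<longleftrightarrow> fcard t \<le> N" if "fset t \<subseteq> adj_level U 0" for t N
  proof (cases "t = {||}")
    case False
    then show ?thesis
      using HSet_funion_in_adj_level_iff[OF False, of "{||}" U 0 N] that by simp
  qed simp
  have "{X. HSet X \<in> adj_level U (Suc n') - adj_level U n' \<and> fset X \<subseteq> adj_level U 0}
      = {t. fset t \<subseteq> adj_level U 0 \<and> fcard t = n}"
    using lev n by auto
  then have "b U (int n) 0 = card (adj_level U 0) choose n"
    using b_int_Suc[of U n' 0] n card_fsubsets[OF finite_adj_level[OF assms(1)], of 0 n] by simp
  also have "card (adj_level U 0) = card U + 1"
    using assms(1) by (auto simp: adj_level.simps card_image inj_on_def card_insert_if)
  finally show ?thesis .
qed

section \<open>The recurrence\<close>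

lemma card_funion_image:
  assumes "C \<inter> D = {}" and "\<And>s. s \<in> S \<Longrightarrow> fset s \<subseteq> C" and "\<And>t. t \<in> T \<Longrightarrow> fset t \<subseteq> D"
  shows "card ((\<lambda>(s, t). s |\<union>| t) ` (S \<times> T)) = card S * card T"
proof -
  \<comment> \<open>Both parts are recovered from the union by intersecting with \<open>C\<close>
    and with \<open>D\<close>.\<close>
  have "inj_on (\<lambda>(s, t). s |\<union>| t) (S \<times> T)"
  proof (rule inj_onI, clarify)
    fix s t s' t'
    assume "s \<in> S" "t \<in> T" "s' \<in> S" "t' \<in> T" and eq: "s |\<union>| t = s' |\<union>| t'"
    then have sub: "fset s \<subseteq> C" "fset s' \<subseteq> C" "fset t \<subseteq> D" "fset t' \<subseteq> D"
      using assms by auto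
    have "fset s \<union> fset t = fset s' \<union> fset t'"
      using eq by (metis union_fset)
    with sub assms(1) have "fset s = fset s'" "fset t = fset t'" by blast+
    then show "s = s' \<and> t = t'" by (simp add: fset_inject)
  qed
  then show ?thesis by (simp add: card_image card_cartesian_product)
qed

lemma b_recurrence:
  assumes fin: "finite U" and nm: "m < n" and m1: "1 \<le> m"
  shows "b U (int n) (int m) =
    b U (int n) (int m - 1)
    + (\<Sum>k = 1..n - m - 1. b U (int n - int k) (int m - 1) * (b U (int m) (int m - 1) choose k))
    + (b U (int m) (int m - 1) choose (n - m)) * (1 + (\<Sum>k = 1..m. b U (int k) (int k - 1)))"
proof -
  obtain p where m: "m = Suc p" using m1 by (cases m) auto
  \<comment> \<open>\<open>C\<close> is level m - 1 and \<open>D\<close> is the layer first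
    appearing at level m, with b_{m,m-1} members. A set included in level m is split along
    them.\<close>
  define C where "C = adj_level U p"
  define D where "D = adj_level U m - adj_level U p"
  \<comment> \<open>The counterpart of \<open>B U N c\<close> without \<open>HSet\<close>, for
    \<open>N >= 1\<close>; at \<open>N = 0\<close> truncated subtraction makes it empty, hence the
    restriction in \<open>bF\<close>.\<close>
  define F where "F N c = {X. HSet X \<in> adj_level U N - adj_level U (N - 1) \<and> fset X \<subseteq> adj_level U c}"
    for N c
  define S where "S k = (if k = n - m then {X. HSet X \<in> adj_level U m} else F (n - k) p)" for k
  define T where "T k = {t. fset t \<subseteq> D \<and> fcard t = k}" for k
  define P where "P k = (\<lambda>(s, t). s |\<union>| t) ` (S k \<times> T k)" for k
  have CD: "C \<inter> D = {}" and CUD: "C \<union> D = adj_level U m"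
    using adj_level_Suc_mono[of U p] by (auto simp: C_def D_def m)
  have finD: "finite D" unfolding D_def using finite_adj_level[OF fin] by blast
  have D_low: "E \<inter> adj_level U j = {}" if "j < m" "E \<subseteq> D" for j E
    using that adj_level_mono[of j p U] by (auto simp: D_def m)
  have bF: "b U (int N) (int c) = card (F N c)" if "N \<ge> 1" for N c
    using that b_int_Suc[of U "N - 1" c] by (simp add: F_def)
  have finF: "finite (F N c)" for N c
    by (rule finite_subset[OF _ finite_HSet_vimage[OF fin, of N]]) (auto simp: F_def)
  have finS: "finite (S k)" for k
    using finF finite_HSet_vimage[OF fin, of m] by (simp add: S_def)
  \<comment> \<open>For \<open>k = n - m\<close> the inclusion is not built into \<open>S k\<close>;
    it holds because a set in level \<open>Suc p\<close> has its elements in level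
    \<open>p\<close>.\<close>
  have S_sub: "fset s \<subseteq> C" if "s \<in> S k" for s k
    using that elems_adj_level_Suc[of "HSet s" U p]
    by (auto simp: S_def F_def C_def m split: if_splits)
  have cardT: "card (T k) = card D choose k" for k
    unfolding T_def by (rule card_fsubsets[OF finD])
  have finT: "finite (T k)" for k
  proof (rule finite_subset)
    show "T k \<subseteq> fset -` Pow D" by (auto simp: T_def)
    show "finite (fset -` Pow D)"
      using finD by (intro finite_vimageI) (auto simp: inj_def fset_inject)
  qed
  have key: "s |\<union>| t \<in> F n m \<longleftrightarrow> fcard t \<in> {1..n - m} \<and> s \<in> S (fcard t)"
    if s: "fset s \<subseteq> C" and t: "fset t \<subseteq> D" "t \<noteq> {||}" for s t
  proof -
    have pos: "fcard t \<ge> 1"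
      using t(2) by (metis One_nat_def Suc_leI fcard_0_eq neq0_conv)
    have sm: "fset s \<subseteq> adj_level U m" and tm: "fset t \<subseteq> adj_level U m"
      using s t CUD by auto
    have "fset s \<inter> fset t = {}" using s t CD by auto
    then have disj: "s |\<inter>| t = {||}" by (metis bot_fset.rep_eq fset_inject inter_fset)
    have lev: "HSet (s |\<union>| t) \<in> adj_level U N \<longleftrightarrow>
        m + fcard t \<le> N \<and> HSet s \<in> adj_level U (N - fcard t)" for N
      by (rule HSet_funion_in_adj_level_iff[OF t(2) disj sm tm]) (use D_low t in blast)
    have "s |\<union>| t \<in> F n m \<longleftrightarrow> m + fcard t \<le> n \<and> HSet s \<in> adj_level U (n - fcard t) \<and>
        \<not> (m + fcard t \<le> n - 1 \<and> HSet s \<in> adj_level U (n - 1 - fcard t))"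
      using lev[of n] lev[of "n - 1"] sm tm by (auto simp: F_def)
    \<comment> \<open>If \<open>fcard t = n - m\<close>, the arithmetic condition fails at
      \<open>n - 1\<close>, so \<open>s\<close> is arbitrary in level \<open>m\<close>. If it is
      smaller, that condition holds at both levels and \<open>s\<close> must be new at level
      \<open>n - fcard t\<close>. If larger, it fails at both.\<close>
    also have "\<dots> \<longleftrightarrow> fcard t \<in> {1..n - m} \<and> s \<in> S (fcard t)"
    proof (cases "fcard t = n - m")
      case True
      then show ?thesis using pos nm by (auto simp: S_def)
    next
      case False
      have "n - 1 - fcard t = n - fcard t - 1" by simp
      then show ?thesis using False pos nm s
        by (auto simp: S_def F_def C_def)
    qed
    finally show ?thesis .
  qed
  \<comment> \<open>The sets with empty \<open>t\<close> form \<open>F n p\<close>, the source of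
    the summand b_{n,m-1}.\<close>
  have split: "F n m = F n p \<union> (\<Union>k\<in>{1..n - m}. P k)"
  proof (intro equalityI subsetI)
    fix X assume X: "X \<in> F n m"
    define s where "s = ffilter (\<lambda>x. x \<in> C) X"
    define t where "t = ffilter (\<lambda>x. x \<in> D) X"
    have "fset X \<subseteq> C \<union> D" using X CUD by (simp add: F_def)
    then have Xst: "X = s |\<union>| t" by (auto simp: s_def t_def)
    have s: "fset s \<subseteq> C" and t: "fset t \<subseteq> D" by (auto simp: s_def t_def)
    show "X \<in> F n p \<union> (\<Union>k\<in>{1..n - m}. P k)"
    proof (cases "t = {||}")
      case True
      then show ?thesis using X Xst s by (auto simp: F_def C_def)
    next
      case False
      then have "fcard t \<in> {1..n - m}" "s \<in> S (fcard t)" using key[OF s t] X Xst by auto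
      moreover have "t \<in> T (fcard t)" using t by (simp add: T_def)
      ultimately show ?thesis unfolding P_def Xst by blast
    qed
  next
    fix X assume "X \<in> F n p \<union> (\<Union>k\<in>{1..n - m}. P k)"
    then consider "X \<in> F n p"
      | k s t where "k \<in> {1..n - m}" "s \<in> S k" "t \<in> T k" "X = s |\<union>| t"
      by (auto simp: P_def)
    then show "X \<in> F n m"
    proof cases
      case 1
      then show ?thesis
        using adj_level_Suc_mono[of U p] by (auto simp: F_def m)
    next
      case (2 k s t)
      then have "fcard t = k" "fset t \<subseteq> D" by (auto simp: T_def)
      moreover from this 2 have "t \<noteq> {||}" by auto
      ultimately show ?thesis using key[OF S_sub[OF 2(2)]] 2 by simp
    qed
  qed
  \<comment> \<open>Since \<open>k\<close> can be read off from \<open>X\<close>, the families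
    \<open>P k\<close> are pairwise disjoint. For \<open>k >= 1\<close> they also miss
    \<open>F n p\<close>, whose members have no element in \<open>D\<close>.\<close>
  have P_D: "card (fset X \<inter> D) = k" if "X \<in> P k" for X k
  proof -
    from that obtain s t where "s \<in> S k" "t \<in> T k" "X = s |\<union>| t" by (auto simp: P_def)
    moreover from this have "fset X \<inter> D = fset t"
      using S_sub CD by (auto simp: T_def)
    ultimately show ?thesis by (simp add: T_def fcard.rep_eq)
  qed
  have cardP: "card (P k) = card (S k) * (card D choose k)" for k
    unfolding P_def cardT[symmetric]
    by (rule card_funion_image[OF CD]) (use S_sub T_def in auto)
  have finP: "finite (P k)" for k
    unfolding P_def using finS finT by blast
  have "card (F n m) = card (F n p) + card (\<Union>k\<in>{1..n - m}. P k)"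
    unfolding split
  proof (rule card_Un_disjoint)
    have "k = 0" if "X \<in> F n p" "X \<in> P k" for X k
      using P_D[OF that(2)] that(1) CD by (auto simp: F_def C_def disjoint_iff)
        (metis Int_emptyI card.empty subset_iff)
    then show "F n p \<inter> (\<Union>k\<in>{1..n - m}. P k) = {}" by fastforce
  qed (use finF finP in auto)
  also have "card (\<Union>k\<in>{1..n - m}. P k) = (\<Sum>k = 1..n - m. card (P k))"
    by (rule card_UN_disjoint) (use finP P_D in blast)+
  also have "\<dots> = (\<Sum>k = 1..n - m. card (S k) * (card D choose k))"
    by (simp only: cardP)
  \<comment> \<open>The index \<open>n - m\<close> is split off because \<open>S\<close> takes its
    exceptional value there.\<close>
  also have "{1..n - m} = insert (n - m) {1..n - m - 1}"
    using nm by auto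
  also have "(\<Sum>k\<in>\<dots>. card (S k) * (card D choose k)) =
      (card D choose (n - m)) * card (S (n - m)) + (\<Sum>k = 1..n - m - 1. card (S k) * (card D choose k))"
    using nm by (subst sum.insert) auto
  also have "card (S (n - m)) = 1 + (\<Sum>k = 1..m. b U (int k) (int k - 1))"
    by (simp add: S_def card_HSet_adj_level[OF fin])
  also have "(\<Sum>k = 1..n - m - 1. card (S k) * (card D choose k)) =
      (\<Sum>k = 1..n - m - 1. b U (int n - int k) (int m - 1) * (card D choose k))"
  proof (rule sum.cong[OF refl])
    fix k assume k: "k \<in> {1..n - m - 1}"
    \<comment> \<open>Here \<open>k < n - m\<close>, so \<open>S k\<close> is
      \<open>F (n - k) p\<close>, and \<open>n - k >= 1\<close> as \<open>bF\<close>
      demands.\<close>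
    then have "b U (int (n - k)) (int p) = card (S k)"
      using nm by (subst bF) (auto simp: S_def)
    moreover have "int (n - k) = int n - int k" using k by auto
    ultimately show "card (S k) * (card D choose k) =
        b U (int n - int k) (int m - 1) * (card D choose k)"
      by (simp add: m)
  qed
  finally have "card (F n m) = card (F n p)
      + ((card D choose (n - m)) * (1 + (\<Sum>k = 1..m. b U (int k) (int k - 1)))
      + (\<Sum>k = 1..n - m - 1. b U (int n - int k) (int m - 1) * (card D choose k)))" .
  moreover have "b U (int m) (int m - 1) = card D"
    using B_Suc_diag[of U p] by (simp add: b_def D_def m)
  moreover have "b U (int n) (int m) = card (F n m)" "b U (int n) (int m - 1) = card (F n p)"
    using bF[of n m] bF[of n p] nm by (simp_all add: m)
  ultimately show ?thesis by simp
qed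

theorem theorem5:
  fixes U :: "'a set" and u :: nat
  assumes "finite U" and "u = card U"
  shows "(\<forall>n m :: nat. n > m \<and> m \<ge> 1 \<longrightarrow>
      b U (int n) (int m) =
        b U (int n) (int m - 1)
        + (\<Sum>k = 1..n - m - 1. b U (int n - int k) (int m - 1) * (b U (int m) (int m - 1) choose k))
        + (b U (int m) (int m - 1) choose (n - m)) * (1 + (\<Sum>k = 1..m. b U (int k) (int k - 1))))
    \<and> b U 0 (- 1) = u + 1
    \<and> (\<forall>n :: nat. n \<ge> 1 \<longrightarrow> b U (int n) 0 = (u + 1) choose n)"
  using b_recurrence[OF assms(1)] b_0[OF assms(1)] b_n_0[OF assms(1)] assms(2) by simp

end
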